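(* Let $k=k_n$ be a sequence of positive integers with $k/\sqrt{n}\to\infty$ and $k/n\to0$ as $n\to\infty$ (so $k\to\infty$), and let $r=r_n$ be integers with $1\le r\le k-1$. For each $n$ let $t=t_n$ be an integer with $0\le t\le\binom{n}{k}$, and let a family of $t$ distinct $k$-element subsets of a fixed $n$-element set be chosen uniformly at random among all such families. Let $X_r$ be the number of unordered pairs of distinct sets in the chosen family which overlap in exactly $r$ elements, and put $$t_0=\sqrt{\frac{2\binom{n}{k}}{\binom{k}{r}\binom{n-k}{k-r}}}.$$ Then, as $n\to\infty$: (i) if $t\ll t_0$, then $\mathbb{P}(X_r=0)\to 1$; (ii) if $t\gg t_0$, then $\mathbb{P}(X_r=0)\to 0$; (iii) if $t=(A+o(1))\,t_0$ for a constant $A>0$, then $\mathbb{P}(X_r=0)\to e^{-A^2}$.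
   Context: For sequences of nonnegative reals, $a_n\ll b_n$ (equivalently $b_n\gg a_n$) means $a_n/b_n\to 0$ as $n\to\infty$. Two sets overlap in exactly $r$ elements if their intersection has cardinality $r$. *)

theory Defs
  imports "HOL-Probability.Probability"
begin

text \<open>Since \<open>x / 0 = 0\<close>, the requirement that \<open>b\<close> is eventually nonzero is needed
  for \<open>a n / b n\<close> to be meaningful: without it the zero sequence would satisfy
  \<open>a \<lless> (\<lambda>_. 0)\<close> for every \<open>a\<close>.\<close>

definition much_less :: "(nat \<Rightarrow> real) \<Rightarrow> (nat \<Rightarrow> real) \<Rightarrow> bool"  (infix "\<lless>" 50) where
  "a \<lless> b \<longleftrightarrow> (\<forall>\<^sub>F n in sequentially. b n \<noteq> 0) \<and> (\<lambda>n. a n / b n) \<longlonglongrightarrow> 0"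

definition k_subsets :: "'a set \<Rightarrow> nat \<Rightarrow> 'a set set" where
  "k_subsets V k = {S. S \<subseteq> V \<and> card S = k}"

text \<open>For finite \<open>V\<close> and \<open>t \<le> card V choose k\<close> the set below is finite and nonempty, so
  \<^const>\<open>pmf_of_set\<close> is the uniform distribution on it.\<close>

definition random_family :: "'a set \<Rightarrow> nat \<Rightarrow> nat \<Rightarrow> 'a set set pmf" where
  "random_family V k t = pmf_of_set {F. F \<subseteq> k_subsets V k \<and> card F = t}"

definition overlap_count :: "nat \<Rightarrow> 'a set set \<Rightarrow> nat" where
  "overlap_count r F = card {{S, T} | S T. S \<in> F \<and> T \<in> F \<and> S \<noteq> T \<and> card (S \<inter> T) = r}"

definition threshold :: "nat \<Rightarrow> nat \<Rightarrow> nat \<Rightarrow> real" where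
  "threshold n k r =
     sqrt (2 * real (n choose k) / (real (k choose r) * real ((n - k) choose (k - r))))"

end

theory Submission
  imports Defs
begin

text \<open>
  Join two \<open>k\<close>-sets when they overlap in exactly \<open>r\<close> elements.  This graph on \<open>N = n choose k\<close>
  vertices is regular of degree \<open>d = (k choose r) * ((n - k) choose (k - r))\<close>, the event \<open>X\<^sub>r = 0\<close>
  says that a random set of \<open>t\<close> vertices is independent, and the threshold is \<open>t\<^sub>0 = sqrt (2 / p)\<close>
  for the density \<open>p = d / N\<close>.

  Draw the vertices one by one and let \<open>q s\<close> be the
  probability that the first \<open>s\<close> are independent.  The next vertex must avoid the neighbourhood of
  those before it, which has at most \<open>s * d\<close> elements, so \<open>q (s + 1)\<close> is at least about
  \<open>q s * (1 - s * p)\<close>.  The neighbourhood is smaller than \<open>s * d\<close> only because of vertices with two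
  neighbours in the sample, and by double counting a random sample has on average at most
  \<open>N * (s * p)\<^sup>2 / 2\<close> pairs with a common neighbour, counted once for each common neighbour; hence
  \<open>q (s + 1) \<le> q s * (1 - s * p) + (s * p)\<^sup>2 / 2\<close>.  Iterating gives \<open>q t\<close> between two quantities close
  to \<open>exp (- t\<^sup>2 * p / 2)\<close> (lemmas \<open>indep_prob_lower\<close> and \<open>indep_prob_upper\<close>), with error \<open>t ^ 3 * p\<^sup>2\<close>.
  For \<open>t\<close> of order at most \<open>t\<^sub>0\<close> this error is of order \<open>sqrt p\<close>, and \<open>t\<^sup>2 * p / 2 = (t / t\<^sub>0)\<^sup>2\<close>; so
  \<open>t / t\<^sub>0 \<longlonglongrightarrow> A\<close> implies \<open>q t \<longlonglongrightarrow> exp (- A\<^sup>2)\<close>, and the limit is 1 for \<open>A = 0\<close>.  For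
  \<open>t\<close> far above \<open>t\<^sub>0\<close> the limit is 0, because \<open>q\<close> is nonincreasing and \<open>A\<close> can be taken arbitrarily
  large.

  It remains to see that \<open>p \<longlonglongrightarrow> 0\<close>, uniformly in \<open>r\<close>.  The number \<open>p\<close> is a value of a hypergeometric
  distribution with mean \<open>k\<^sup>2 / n \<longlonglongrightarrow> \<infinity>\<close>.  Near the mode its consecutive values have ratio close to
  1, so arbitrarily many values have at least half the size of the largest one; as they sum to at
  most 1, the largest one tends to 0 (lemma \<open>hypergeometric_tendsto_0\<close>).
\<close>

section \<open>Random vertex sets in a regular graph\<close>

locale finite_regular_graph =
  fixes U :: "'v set" and adj :: "'v \<Rightarrow> 'v \<Rightarrow> bool" and d :: nat
  assumes finite_U: "finite U"
    and adj_sym: "adj x y \<Longrightarrow> adj y x"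
    and adj_irrefl: "x \<in> U \<Longrightarrow> \<not> adj x x"
    and regular: "x \<in> U \<Longrightarrow> card {y \<in> U. adj x y} = d"
begin

definition nbhd :: "'v set \<Rightarrow> 'v set" where
  "nbhd S = {y \<in> U. \<exists>x\<in>S. adj x y}"

definition subsets_of_size :: "nat \<Rightarrow> 'v set set" where
  "subsets_of_size s = {S. S \<subseteq> U \<and> card S = s}"

definition indep_sets :: "nat \<Rightarrow> 'v set set" where
  "indep_sets s = {S. S \<subseteq> U \<and> card S = s \<and> (\<forall>x\<in>S. \<forall>y\<in>S. \<not> adj x y)}"

definition indep_prob :: "nat \<Rightarrow> real" where
  "indep_prob s = real (card (indep_sets s)) / real (card U choose s)"

lemma finite_subsets_of_size [simp]: "finite (subsets_of_size s)"
  unfolding subsets_of_size_def using finite_U by auto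

lemma card_subsets_of_size: "card (subsets_of_size s) = card U choose s"
  unfolding subsets_of_size_def using n_subsets[OF finite_U] by simp

lemma indep_sets_subset: "indep_sets s \<subseteq> subsets_of_size s"
  unfolding indep_sets_def subsets_of_size_def by auto

lemma finite_indep_sets [simp]: "finite (indep_sets s)"
  using indep_sets_subset finite_subsets_of_size by (rule finite_subset)

lemma indep_prob_nonneg: "0 \<le> indep_prob s"
  unfolding indep_prob_def by simp

lemma indep_prob_0: "indep_prob 0 = 1"
proof -
  have "indep_sets 0 = {{}}"
    unfolding indep_sets_def using finite_U by (auto dest: finite_subset)
  then show ?thesis
    unfolding indep_prob_def by simp
qed

text \<open>
  Both sides count the independent sets of size \<open>s + 1\<close> with one marked vertex: deleting the marked
  vertex \<open>y\<close> leaves an independent \<open>S\<close>, and \<open>y\<close> can be any vertex outside \<open>S\<close> and its neighbourhood.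
\<close>
lemma card_indep_sets_Suc:
  "Suc s * card (indep_sets (Suc s)) = (\<Sum>S\<in>indep_sets s. card (U - S - nbhd S))"
proof -
  have fin: "finite S" if "S \<in> indep_sets s" for S s
    using that finite_U unfolding indep_sets_def by (auto dest: finite_subset)
  have "bij_betw (\<lambda>(S, y). (insert y S, y))
          (SIGMA S:indep_sets s. U - S - nbhd S) (SIGMA T:indep_sets (Suc s). T)"
  proof (rule bij_betwI[where g = "\<lambda>(T, y). (T - {y}, y)"])
    show "(\<lambda>(S, y). (insert y S, y)) \<in> (SIGMA S:indep_sets s. U - S - nbhd S) \<rightarrow> (SIGMA T:indep_sets (Suc s). T)"
    proof safe
      fix S y assume S: "S \<in> indep_sets s" and y: "y \<in> U" "y \<notin> S" "y \<notin> nbhd S"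
      have "card (insert y S) = Suc s"
        using S fin[OF S] y unfolding indep_sets_def by simp
      then show "insert y S \<in> indep_sets (Suc s)"
        using S y adj_irrefl adj_sym unfolding indep_sets_def nbhd_def by blast
    qed
    show "(\<lambda>(T, y). (T - {y}, y)) \<in> (SIGMA T:indep_sets (Suc s). T) \<rightarrow> (SIGMA S:indep_sets s. U - S - nbhd S)"
    proof safe
      fix T y assume T: "T \<in> indep_sets (Suc s)" and y: "y \<in> T"
      show "T - {y} \<in> indep_sets s"
        using T y fin[OF T] unfolding indep_sets_def by auto
      show "y \<in> U" using T y unfolding indep_sets_def by auto
      assume "y \<in> nbhd (T - {y})"
      then show False using T y unfolding indep_sets_def nbhd_def by auto
    qed
  qed auto
  from bij_betw_same_card[OF this]
  have "(\<Sum>S\<in>indep_sets s. card (U - S - nbhd S)) = (\<Sum>T\<in>indep_sets (Suc s). card T)"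
    using finite_U by (subst (asm) (1 2) card_SigmaI) (auto dest: fin)
  also have "\<dots> = (\<Sum>T\<in>indep_sets (Suc s). Suc s)"
    by (rule sum.cong) (auto simp: indep_sets_def)
  finally show ?thesis by simp
qed

text \<open>
  Read as a sampling process: the next vertex is uniform among the remaining ones, and independence
  survives if it avoids the neighbourhood of the vertices drawn before.
\<close>
lemma indep_prob_Suc:
  assumes "s < card U"
  shows "indep_prob (Suc s) =
    (\<Sum>S\<in>indep_sets s. real (card (U - S - nbhd S)) / real (card U - s)) / real (card U choose s)"
proof -
  have "Suc s * (card U choose Suc s) = (card U - s) * (card U choose s)"
    using assms by (metis binomial_absorb_comp binomial_absorption mult.commute)
  then have 1: "real (Suc s) * real (card U choose Suc s) = real (card U - s) * real (card U choose s)"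
    by (metis of_nat_mult)
  have 2: "real (card U choose Suc s) > 0" "real (card U choose s) > 0" "real (card U - s) > 0"
    using assms by auto
  have 3: "real (Suc s) * real (card (indep_sets (Suc s))) =
      (\<Sum>S\<in>indep_sets s. real (card (U - S - nbhd S)))"
    using card_indep_sets_Suc[of s] by (metis of_nat_mult of_nat_sum)
  have "indep_prob (Suc s) = (real (Suc s) * real (card (indep_sets (Suc s)))) /
     (real (Suc s) * real (card U choose Suc s))"
    unfolding indep_prob_def by (simp del: of_nat_Suc)
  also have "\<dots> = (\<Sum>S\<in>indep_sets s. real (card (U - S - nbhd S))) /
     (real (card U - s) * real (card U choose s))"
    unfolding 1 3 ..
  finally show ?thesis by (simp add: sum_divide_distrib)
qed

lemma card_free_vertices:
  assumes "S \<in> indep_sets s"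
  shows "card (U - S - nbhd S) + card (nbhd S) = card U - s"
proof -
  have S: "S \<subseteq> U" "card S = s" "finite S" "S \<inter> nbhd S = {}" "nbhd S \<subseteq> U"
    using assms finite_U unfolding indep_sets_def nbhd_def by (auto dest: finite_subset)
  have "card (U - S) = card U - s" using S by (simp add: card_Diff_subset)
  moreover have "card (U - S) = card (U - S - nbhd S) + card (nbhd S)"
    using S finite_U
    by (subst card_Un_disjoint[symmetric]) (auto intro!: arg_cong[where f = card] finite_subset[OF S(5)])
  ultimately show "card (U - S - nbhd S) + card (nbhd S) = card U - s" by simp
qed

lemma card_nbhd_le:
  assumes "S \<in> subsets_of_size s"
  shows "card (nbhd S) \<le> s * d"
proof -
  have S: "S \<subseteq> U" "card S = s" "finite S"
    using assms finite_U unfolding subsets_of_size_def by (auto dest: finite_subset)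
  have "nbhd S = (\<Union>x\<in>S. {y\<in>U. adj x y})" unfolding nbhd_def by auto
  then have "card (nbhd S) \<le> (\<Sum>x\<in>S. card {y\<in>U. adj x y})"
    using card_UN_le[OF S(3)] by simp
  also have "\<dots> = s * d" using S regular by (simp add: subset_iff)
  finally show ?thesis .
qed

lemma indep_prob_Suc_le:
  assumes "s < card U"
  shows "indep_prob (Suc s) \<le> indep_prob s"
proof -
  have "(\<Sum>S\<in>indep_sets s. real (card (U - S - nbhd S)) / real (card U - s)) \<le> (\<Sum>S\<in>indep_sets s. 1)"
    using assms card_free_vertices by (intro sum_mono) (fastforce simp: divide_simps)
  then show ?thesis
    unfolding indep_prob_Suc[OF assms] by (simp add: indep_prob_def divide_right_mono)
qed

lemma indep_prob_antimono:
  assumes "s \<le> t" "t \<le> card U"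
  shows "indep_prob t \<le> indep_prob s"
  using assms
proof (induction t rule: dec_induct)
  case (step j)
  then show ?case using indep_prob_Suc_le[of j] by simp
qed simp

text \<open>By the union bound, at most \<open>s * d\<close> vertices are forbidden in the next draw.\<close>
lemma indep_prob_Suc_lower:
  assumes "s < card U"
  shows "indep_prob s * (1 - real (s * d) / real (card U - s)) \<le> indep_prob (Suc s)"
proof -
  have "1 - real (s * d) / real (card U - s) \<le> real (card (U - S - nbhd S)) / real (card U - s)"
    if S: "S \<in> indep_sets s" for S
  proof -
    have "real (card (U - S - nbhd S)) \<ge> real (card U - s) - real (s * d)"
      using card_free_vertices[OF S] card_nbhd_le[of S s] S indep_sets_subset[of s]
      by (metis add.commute add_le_cancel_right diff_le_eq of_nat_add of_nat_le_iff subsetD add_left_mono)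
    then have "(real (card U - s) - real (s * d)) / real (card U - s) \<le> real (card (U - S - nbhd S)) / real (card U - s)"
      by (rule divide_right_mono) simp
    then show ?thesis using assms by (simp add: diff_divide_distrib)
  qed
  then have "(\<Sum>S\<in>indep_sets s. 1 - real (s * d) / real (card U - s)) \<le>
     (\<Sum>S\<in>indep_sets s. real (card (U - S - nbhd S)) / real (card U - s))"
    by (rule sum_mono)
  then show ?thesis
    unfolding indep_prob_Suc[OF assms]
    by (simp add: indep_prob_def divide_right_mono del: of_nat_mult)
qed

lemma card_supersets_of_size:
  assumes "P \<subseteq> U" "card P \<le> s"
  shows "card {S \<in> subsets_of_size s. P \<subseteq> S} = (card U - card P) choose (s - card P)"
proof -
  have fP: "finite P" using assms finite_U finite_subset by blast
  have "bij_betw (\<lambda>Q. P \<union> Q) {Q. Q \<subseteq> U - P \<and> card Q = s - card P} {S \<in> subsets_of_size s. P \<subseteq> S}"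
  proof (rule bij_betwI[where g = "\<lambda>S. S - P"])
    show "(\<lambda>Q. P \<union> Q) \<in> {Q. Q \<subseteq> U - P \<and> card Q = s - card P} \<rightarrow> {S \<in> subsets_of_size s. P \<subseteq> S}"
    proof safe
      fix Q assume Q: "Q \<subseteq> U - P" "card Q = s - card P"
      have "finite Q" using Q finite_U finite_subset by blast
      then have "card (P \<union> Q) = s"
        using Q assms fP by (subst card_Un_disjoint) auto
      then show "P \<union> Q \<in> subsets_of_size s"
        unfolding subsets_of_size_def using Q assms by auto
    qed
    show "(\<lambda>S. S - P) \<in> {S \<in> subsets_of_size s. P \<subseteq> S} \<rightarrow> {Q. Q \<subseteq> U - P \<and> card Q = s - card P}"
      using fP unfolding subsets_of_size_def by (auto simp: card_Diff_subset)
  qed auto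
  then have "card {S \<in> subsets_of_size s. P \<subseteq> S} = card {Q. Q \<subseteq> U - P \<and> card Q = s - card P}"
    by (simp add: bij_betw_same_card)
  also have "\<dots> = card (U - P) choose (s - card P)"
    using finite_U by (intro n_subsets) auto
  finally show ?thesis using assms fP by (simp add: card_Diff_subset)
qed

text \<open>
  A random \<open>s\<close>-set contains a given pair with probability \<open>s (s - 1) / (N (N - 1))\<close>, where \<open>N\<close> is the
  number of vertices.  Summing over the pairs in a neighbourhood \<open>D\<close> gives the expected number of
  pairs that the random set has in \<open>D\<close>, that is, of pairs with a given common neighbour.
\<close>
lemma sum_pairs_in_common:
  assumes D: "D \<subseteq> U" "card D = d" and s: "s \<le> card U"
  shows "(\<Sum>S\<in>subsets_of_size s. real (card (S \<inter> D) choose 2))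
     \<le> real (card U choose s) * (real s * real d / real (card U))\<^sup>2 / 2"
proof (cases "2 \<le> s")
  case False
  have "card (S \<inter> D) choose 2 = 0" if "S \<in> subsets_of_size s" for S
  proof -
    have "card (S \<inter> D) \<le> s"
      using that finite_U unfolding subsets_of_size_def by (auto intro!: card_mono dest: finite_subset)
    then show ?thesis using False by simp
  qed
  then show ?thesis by (simp add: sum.neutral)
next
  case True
  define N where "N = card U"
  define pairs where "pairs = {P. P \<subseteq> D \<and> card P = 2}"
  have fD: "finite D" using D finite_U finite_subset by blast
  then have fp: "finite pairs" unfolding pairs_def by auto
  have dN: "d \<le> N" using D finite_U card_mono unfolding N_def by blast
  have N2: "2 \<le> N" using True s N_def by simp
  have "(\<Sum>S\<in>subsets_of_size s. card (S \<inter> D) choose 2) =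
     (\<Sum>S\<in>subsets_of_size s. \<Sum>P\<in>pairs. if P \<subseteq> S then 1 else 0)"
  proof (rule sum.cong)
    fix S assume "S \<in> subsets_of_size s"
    have "card (S \<inter> D) choose 2 = card {P. P \<subseteq> S \<inter> D \<and> card P = 2}"
      using fD by (subst n_subsets) auto
    also have "{P. P \<subseteq> S \<inter> D \<and> card P = 2} = {P \<in> pairs. P \<subseteq> S}"
      unfolding pairs_def by auto
    also have "card \<dots> = (\<Sum>P\<in>pairs. if P \<subseteq> S then 1 else 0)"
      using fp by (simp add: sum.If_cases Int_def)
    finally show "card (S \<inter> D) choose 2 = (\<Sum>P\<in>pairs. if P \<subseteq> S then 1 else 0)" .
  qed simp
  also have "\<dots> = (\<Sum>P\<in>pairs. card {S \<in> subsets_of_size s. P \<subseteq> S})"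
    by (subst sum.swap) (simp add: sum.If_cases Int_def)
  also have "\<dots> = (\<Sum>P\<in>pairs. (N - 2) choose (s - 2))"
    using D True card_supersets_of_size unfolding pairs_def N_def by (intro sum.cong) auto
  also have "\<dots> = (d choose 2) * ((N - 2) choose (s - 2))"
    using n_subsets[OF fD, of 2] D unfolding pairs_def by simp
  finally have eq: "(\<Sum>S\<in>subsets_of_size s. real (card (S \<inter> D) choose 2)) =
      real (d choose 2) * real ((N - 2) choose (s - 2))"
    by (metis of_nat_mult of_nat_sum)
  have "(N choose s) * (s choose 2) = (N choose 2) * ((N - 2) choose (s - 2))"
    using True s unfolding N_def by (intro choose_mult) auto
  then have "real (N choose s) * real (s choose 2) = real (N choose 2) * real ((N - 2) choose (s - 2))"
    by (metis of_nat_mult)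
  moreover have c2: "real (m choose 2) = real m * (real m - 1) / 2" for m
    by (cases m) (auto simp: choose_two real_of_nat_div algebra_simps)
  ultimately have sub: "real ((N - 2) choose (s - 2)) =
      real (N choose s) * (real s * (real s - 1)) / (real N * (real N - 1))"
    using N2 by (simp add: field_simps)
  have a: "real d * (real d - 1) / (real N * (real N - 1)) \<le> (real d / real N)\<^sup>2"
  proof -
    have "(real d - 1) / (real N - 1) \<le> real d / real N"
      using dN N2 by (simp add: divide_simps) (simp add: algebra_simps)
    then have "(real d / real N) * ((real d - 1) / (real N - 1)) \<le> (real d / real N) * (real d / real N)"
      by (intro mult_left_mono) auto
    then show ?thesis by (simp add: power2_eq_square)
  qed
  have b: "real s * (real s - 1) \<le> (real s)\<^sup>2"
    by (simp add: power2_eq_square algebra_simps)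
  have "real (d choose 2) * real ((N - 2) choose (s - 2)) =
     real (N choose s) / 2 * ((real s * (real s - 1)) * (real d * (real d - 1) / (real N * (real N - 1))))"
    unfolding sub c2 by simp
  also have "\<dots> \<le> real (N choose s) / 2 * ((real s)\<^sup>2 * (real d / real N)\<^sup>2)"
    using a b True by (intro mult_left_mono order.trans[OF mult_left_mono[OF a] mult_right_mono[OF b]]) auto
  finally show ?thesis unfolding eq N_def by (simp add: power_mult_distrib power_divide)
qed

text \<open>
  If \<open>m v\<close> is the number of neighbours of \<open>v\<close> in \<open>S\<close>, then the \<open>m v\<close> add up to \<open>s * d\<close>, and
  \<open>m - (m choose 2) \<le> 1\<close> for \<open>m \<ge> 1\<close>, with \<open>0\<close> for \<open>m = 0\<close>: the first two terms of inclusion-exclusion.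
\<close>
lemma card_nbhd_ge:
  assumes "S \<in> subsets_of_size s"
  shows "real (s * d) - (\<Sum>v\<in>U. real (card (S \<inter> {x \<in> U. adj v x}) choose 2)) \<le> real (card (nbhd S))"
proof -
  have S: "S \<subseteq> U" "card S = s" "finite S"
    using assms finite_U unfolding subsets_of_size_def by (auto dest: finite_subset)
  let ?m = "\<lambda>v. card (S \<inter> {x \<in> U. adj v x})"
  have "(\<Sum>v\<in>U. ?m v) = (\<Sum>v\<in>U. \<Sum>x\<in>S. if adj v x then 1 else 0)"
    using S by (intro sum.cong) (auto simp: sum.If_cases intro!: arg_cong[where f = card])
  also have "\<dots> = (\<Sum>x\<in>S. card {v \<in> U. adj x v})"
    using finite_U adj_sym
    by (subst sum.swap) (auto simp: sum.If_cases intro!: sum.cong arg_cong[where f = card])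
  also have "\<dots> = s * d" using S regular by (simp add: subset_iff)
  finally have 1: "(\<Sum>v\<in>U. real (?m v)) = real (s * d)"
    by (metis of_nat_sum)
  have 2: "real (?m v) - real (?m v choose 2) \<le> (if v \<in> nbhd S then 1 else 0)" if "v \<in> U" for v
  proof (cases "?m v = 0")
    case False
    then have "v \<in> nbhd S"
      using that S adj_sym unfolding nbhd_def by (auto simp: card_eq_0_iff)
    moreover have "?m v \<le> 1 + (?m v choose 2)"
      by (cases "?m v") (auto simp: numeral_2_eq_2)
    ultimately show ?thesis by (simp flip: of_nat_le_iff[where 'a = real] add: le_diff_eq)
  qed auto
  have "real (s * d) - (\<Sum>v\<in>U. real (?m v choose 2)) = (\<Sum>v\<in>U. real (?m v) - real (?m v choose 2))"
    unfolding 1[symmetric] by (simp add: sum_subtractf)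
  also have "\<dots> \<le> (\<Sum>v\<in>U. if v \<in> nbhd S then 1 else 0)"
    using 2 by (rule sum_mono)
  also have "\<dots> = real (card (nbhd S))"
    using finite_U by (simp add: sum.If_cases nbhd_def Int_def)
  finally show ?thesis .
qed

text \<open>
  Vertices that are forbidden more than once make the union bound inexact.  Their contribution is a
  sum over the independent sets; extending it to all sets of size \<open>s\<close> only increases it, and over
  all sets double counting determines the average from \<open>d\<close>.
\<close>
lemma indep_prob_Suc_upper:
  assumes "s < card U"
  defines "p \<equiv> real d / real (card U)"
  shows "indep_prob (Suc s) \<le> indep_prob s * (1 - real s * p) + (real s * p)\<^sup>2 / 2"
proof -
  let ?N = "card U"
  let ?c = "\<lambda>S. \<Sum>v\<in>U. real (card (S \<inter> {x \<in> U. adj v x}) choose 2)"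
  have pos: "real ?N > 0" "real (?N choose s) > 0" using assms(1) by auto
  have "real (card (U - S - nbhd S)) / real (?N - s) \<le> (1 - real s * p) + ?c S / real ?N"
    if S: "S \<in> indep_sets s" for S
  proof -
    have "real (card (U - S - nbhd S)) = real (?N - s) - real (card (nbhd S))"
      using card_free_vertices[OF S] by linarith
    then have "real (card (U - S - nbhd S)) / real (?N - s) = 1 - real (card (nbhd S)) / real (?N - s)"
      using assms(1) by (simp add: diff_divide_distrib)
    also have "\<dots> \<le> 1 - real (card (nbhd S)) / real ?N"
      using assms(1) by (simp add: frac_le)
    also have "\<dots> \<le> 1 - (real (s * d) - ?c S) / real ?N"
      using card_nbhd_ge[of S s] S indep_sets_subset[of s]
      by (intro diff_left_mono divide_right_mono) auto
    finally show ?thesis unfolding p_def by (simp add: diff_divide_distrib)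
  qed
  then have "(\<Sum>S\<in>indep_sets s. real (card (U - S - nbhd S)) / real (?N - s))
     \<le> (\<Sum>S\<in>indep_sets s. (1 - real s * p) + ?c S / real ?N)"
    by (rule sum_mono)
  also have "\<dots> = real (card (indep_sets s)) * (1 - real s * p) + (\<Sum>S\<in>indep_sets s. ?c S) / real ?N"
    by (simp add: sum.distrib sum_divide_distrib)
  also have "\<dots> \<le> real (card (indep_sets s)) * (1 - real s * p) + real (?N choose s) * (real s * p)\<^sup>2 / 2"
  proof -
    have "(\<Sum>S\<in>indep_sets s. ?c S) \<le> (\<Sum>S\<in>subsets_of_size s. ?c S)"
      using indep_sets_subset by (intro sum_mono2) (auto intro: sum_nonneg)
    also have "\<dots> = (\<Sum>v\<in>U. \<Sum>S\<in>subsets_of_size s. real (card (S \<inter> {x \<in> U. adj v x}) choose 2))"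
      by (rule sum.swap)
    also have "\<dots> \<le> (\<Sum>v\<in>U. real (?N choose s) * (real s * p)\<^sup>2 / 2)"
      using sum_pairs_in_common[of "{x \<in> U. adj v x}" s for v] regular assms(1)
      unfolding p_def by (intro sum_mono) auto
    also have "\<dots> = real (?N choose s) * (real s * p)\<^sup>2 / 2 * real ?N" by simp
    finally show ?thesis using pos by (simp add: divide_le_eq)
  qed
  finally have "indep_prob (Suc s) \<le> (real (card (indep_sets s)) * (1 - real s * p) +
      real (?N choose s) * (real s * p)\<^sup>2 / 2) / real (?N choose s)"
    unfolding indep_prob_Suc[OF assms(1)] by (rule divide_right_mono) simp
  also have "\<dots> = indep_prob s * (1 - real s * p) + (real s * p)\<^sup>2 / 2"
    using pos unfolding indep_prob_def by (simp add: add_divide_distrib)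
  finally show ?thesis .
qed

text \<open>
  The factors \<open>1 - s * p \<le> exp (- s * p)\<close> multiply to the main term.  The errors
  \<open>(s * p)\<^sup>2 / 2 \<le> t\<^sup>2 * p\<^sup>2\<close> of the \<open>t\<close> steps merely add up, since later factors are at most 1; near
  the threshold, where \<open>t\<^sup>2 * p\<close> is bounded, their sum is of the order of \<open>sqrt p\<close>.
\<close>
lemma indep_prob_upper:
  assumes "t \<le> card U"
  defines "p \<equiv> real d / real (card U)"
  shows "indep_prob t \<le> exp (- (real t * (real t - 1) / 2 * p)) + real t ^ 3 * p\<^sup>2"
proof -
  have p0: "p \<ge> 0" unfolding p_def by simp
  have "indep_prob s \<le> exp (- (real s * (real s - 1) / 2 * p)) + real s * (real t)\<^sup>2 * p\<^sup>2" if "s \<le> t" for s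
    using that
  proof (induction s)
    case (Suc s)
    let ?e = "exp (- (real s * (real s - 1) / 2 * p))" and ?E = "real s * (real t)\<^sup>2 * p\<^sup>2"
    have "(real s)\<^sup>2 * p\<^sup>2 \<le> (real t)\<^sup>2 * p\<^sup>2"
      using Suc.prems by (intro mult_right_mono power_mono) auto
    then have st: "(real s * p)\<^sup>2 / 2 \<le> (real t)\<^sup>2 * p\<^sup>2"
      by (simp add: power_mult_distrib) (smt (verit) mult_nonneg_nonneg zero_le_power2)
    have "indep_prob (Suc s) \<le> indep_prob s * (1 - real s * p) + (real s * p)\<^sup>2 / 2"
      using indep_prob_Suc_upper[of s] Suc.prems assms by simp
    also have "\<dots> \<le> indep_prob s * exp (- (real s * p)) + (real s * p)\<^sup>2 / 2"
      using exp_ge_add_one_self[of "- (real s * p)"] indep_prob_nonneg by (simp add: mult_left_mono)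
    also have "\<dots> \<le> (?e + ?E) * exp (- (real s * p)) + (real t)\<^sup>2 * p\<^sup>2"
      using Suc st by (intro add_mono mult_right_mono) auto
    also have "\<dots> \<le> ?e * exp (- (real s * p)) + ?E + (real t)\<^sup>2 * p\<^sup>2"
    proof -
      have "?E * exp (- (real s * p)) \<le> ?E * 1"
        using p0 by (intro mult_left_mono) auto
      then show ?thesis by (simp add: algebra_simps)
    qed
    also have "?e * exp (- (real s * p)) = exp (- (real (Suc s) * (real (Suc s) - 1) / 2 * p))"
      by (simp add: exp_add[symmetric] field_simps)
    finally show ?case by (simp add: algebra_simps)
  qed (simp add: indep_prob_0)
  from this[of t] show ?thesis by (simp add: power3_eq_cube power2_eq_square)
qed

text \<open>
  For \<open>0 \<le> x < 1\<close>, \<open>1 - x \<ge> exp (- x / (1 - x))\<close>.  With \<open>x = s * d / (N - s)\<close> the exponent is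
  \<open>s * d / (N - s - s * d)\<close>, and \<open>s + s * d \<le> 2 * t * d\<close> because \<open>d \<ge> 1\<close>; this bounds it by
  \<open>s * p / (1 - 2 * t * p)\<close>, which is linear in \<open>s\<close>.
\<close>
lemma indep_prob_lower:
  assumes "t \<le> card U" "d \<ge> 1"
  defines "p \<equiv> real d / real (card U)"
  assumes small: "2 * real t * p < 1"
  shows "exp (- ((real t)\<^sup>2 * p / 2 / (1 - 2 * real t * p))) \<le> indep_prob t"
proof -
  define c where "c = p / (1 - 2 * real t * p)"
  have p0: "p \<ge> 0" unfolding p_def by simp
  then have c0: "c \<ge> 0" unfolding c_def using small by simp
  have "exp (- (real s * (real s - 1) / 2 * c)) \<le> indep_prob s" if "s \<le> t" for s
    using that
  proof (induction s)
    case (Suc s)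
    define N where "N = real (card U)"
    define x where "x = real s * real d / (N - real s)"
    have N: "N > 0" "real s < N" "real s \<le> real t" using Suc.prems assms(1) by (auto simp: N_def)
    have dp: "real d = p * N" unfolding p_def N_def using N N_def by simp
    have tN: "real t \<le> real t * real d" using assms(2) by (simp add: mult_le_cancel_left1)
    have key: "N * (1 - 2 * real t * p) \<le> N - real s - real s * real d"
    proof -
      have "real s * real d \<le> real t * real d" using N by (intro mult_right_mono) auto
      then have "real s + real s * real d \<le> 2 * (real t * real d)" using tN N(3) by linarith
      then show ?thesis unfolding dp by (simp add: algebra_simps)
    qed
    have pos: "0 < N * (1 - 2 * real t * p)" using N small by simp
    then have pos2: "0 < N - real s - real s * real d" using key by linarith
    have x1: "1 - x = (N - real s - real s * real d) / (N - real s)"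
      unfolding x_def using N by (simp add: field_simps)
    have x1pos: "1 - x > 0" unfolding x1 using pos2 N by simp
    have xx: "x / (1 - x) = real s * real d / (N - real s - real s * real d)"
      unfolding x1 using N pos2 by (simp add: x_def)
    also have "\<dots> \<le> real s * real d / (N * (1 - 2 * real t * p))"
      using key pos using N small by (intro divide_left_mono mult_pos_pos pos2) auto
    also have "\<dots> = real s * c" unfolding dp c_def using N by simp
    finally have le: "x / (1 - x) \<le> real s * c" .
    have "1 / (1 - x) = 1 + x / (1 - x)" using x1pos by (simp add: field_simps)
    also have "\<dots> \<le> exp (real s * c)"
      using exp_ge_add_one_self[of "real s * c"] le by linarith
    finally have "exp (- (real s * c)) \<le> 1 - x"
      using x1pos by (simp add: exp_minus field_simps)
    then have "exp (- (real s * (real s - 1) / 2 * c)) * exp (- (real s * c)) \<le> indep_prob s * (1 - x)"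
      using Suc indep_prob_nonneg by (intro mult_mono) auto
    also have "\<dots> \<le> indep_prob (Suc s)"
      using indep_prob_Suc_lower[of s] Suc.prems assms(1) by (simp add: x_def N_def of_nat_diff)
    also have "exp (- (real s * (real s - 1) / 2 * c)) * exp (- (real s * c)) =
        exp (- (real (Suc s) * (real (Suc s) - 1) / 2 * c))"
      by (simp add: exp_add[symmetric] field_simps)
    finally show ?case .
  qed (simp add: indep_prob_0)
  then have "exp (- (real t * (real t - 1) / 2 * c)) \<le> indep_prob t" by simp
  moreover have "real t * (real t - 1) / 2 * c \<le> (real t)\<^sup>2 * p / 2 / (1 - 2 * real t * p)"
  proof -
    have "real t * (real t - 1) / 2 * c \<le> (real t)\<^sup>2 / 2 * c"
      using c0 by (intro mult_right_mono) (auto simp: power2_eq_square algebra_simps)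
    then show ?thesis by (simp add: c_def)
  qed
  ultimately show ?thesis by (meson exp_le_cancel_iff neg_le_iff_le order_trans)
qed

end

section \<open>Flatness of the hypergeometric distribution\<close>

text \<open>
  The probability that a random \<open>k\<close>-subset of an \<open>n\<close>-set meets a fixed \<open>k\<close>-subset in \<open>j\<close> points.
\<close>
definition hypergeometric :: "nat \<Rightarrow> nat \<Rightarrow> nat \<Rightarrow> real" where
  "hypergeometric n k j = real (k choose j) * real ((n - k) choose (k - j)) / real (n choose k)"

lemma hypergeometric_nonneg: "0 \<le> hypergeometric n k j"
  unfolding hypergeometric_def by simp

lemma sum_hypergeometric:
  assumes "k \<le> n"
  shows "(\<Sum>j\<le>k. hypergeometric n k j) = 1"
proof -
  have "(\<Sum>j\<le>k. (k choose j) * ((n - k) choose (k - j))) = n choose k"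
    using vandermonde[of k "n - k" k] assms by simp
  then have "(\<Sum>j\<le>k. real (k choose j) * real ((n - k) choose (k - j))) = real (n choose k)"
    by (metis (no_types, lifting) of_nat_mult of_nat_sum sum.cong)
  then show ?thesis
    unfolding hypergeometric_def using assms by (simp flip: sum_divide_distrib)
qed

lemma hypergeometric_Suc:
  assumes "j < k" "2 * k \<le> n"
  shows "hypergeometric n k (Suc j) * ((real j + 1) * (real n - 2 * real k + real j + 1)) =
         hypergeometric n k j * (real k - real j)\<^sup>2"
proof -
  have "(k choose Suc j) * Suc j = (k choose j) * (k - j)"
    by (metis assms(1) binomial_absorb_comp binomial_absorption mult.commute)
  then have 1: "real (k choose Suc j) * (real j + 1) = real (k choose j) * (real k - real j)"
    using assms by (metis of_nat_mult of_nat_Suc of_nat_diff less_imp_le add.commute)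
  let ?i = "k - Suc j"
  have "((n - k) choose Suc ?i) * Suc ?i = ((n - k) choose ?i) * (n - k - ?i)"
    by (metis binomial_absorb_comp binomial_absorption mult.commute)
  moreover have "Suc ?i = k - j" using assms by simp
  ultimately have "real ((n - k) choose (k - j)) * real (k - j) = real ((n - k) choose ?i) * real (n - k - ?i)"
    by (metis of_nat_mult)
  moreover have "real (k - j) = real k - real j" "real (n - k - ?i) = real n - 2 * real k + real j + 1"
    using assms by (auto simp: of_nat_diff)
  ultimately have 2: "real ((n - k) choose (k - j)) * (real k - real j) =
      real ((n - k) choose ?i) * (real n - 2 * real k + real j + 1)" by simp
  have "(real (k choose Suc j) * (real j + 1)) * (real ((n - k) choose ?i) * (real n - 2 * real k + real j + 1)) =
      (real (k choose j) * (real k - real j)) * (real ((n - k) choose (k - j)) * (real k - real j))"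
    unfolding 1 2 ..
  then show ?thesis
    unfolding hypergeometric_def by (simp add: power2_eq_square mult_ac)
qed

text \<open>
  The step ratio from \<open>m + j\<close> is \<open>(a - i)\<^sup>2 / ((m + i) * (b + i))\<close> with \<open>a = k - m + 1\<close>,
  \<open>b = n - 2 * k + m\<close> and \<open>i = j + 1\<close>.  At a mode \<open>m\<close> the ratio \<open>a\<^sup>2 / (m * b)\<close> of the step into \<open>m\<close> is at
  least 1, and if \<open>m\<close>, \<open>a\<close> and \<open>b\<close> are at least \<open>L\<close>, then each of the four factors loses at most the
  proportion \<open>M / L\<close> when shifted by \<open>i \<le> M\<close>.
\<close>
lemma hypergeometric_Suc_ge_near_mode:
  assumes m: "1 \<le> m" "m + j < k" "2 * k \<le> n"
    and mode: "hypergeometric n k (m - 1) \<le> hypergeometric n k m"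
    and pos: "hypergeometric n k (m - 1) > 0"
    and L: "L \<le> real m" "L \<le> real k - real m + 1" "L \<le> real n - 2 * real k + real m"
    and j: "real j + 1 \<le> M" "M \<le> L"
  shows "hypergeometric n k (m + j) * (1 - M / L) ^ 4 \<le> hypergeometric n k (Suc (m + j))"
proof -
  define a b where "a = real k - real m + 1" and "b = real n - 2 * real k + real m"
  have L0: "L > 0" "M > 0" using j by auto
  have ab: "a > 0" "b > 0" "real m > 0" using L L0 m by (auto simp: a_def b_def)
  have "hypergeometric n k m * (real m * b) = hypergeometric n k (m - 1) * a\<^sup>2"
    using hypergeometric_Suc[of "m - 1" k n] m by (simp add: a_def b_def of_nat_diff algebra_simps)
  also have "\<dots> \<le> hypergeometric n k m * a\<^sup>2"
    using mode by (intro mult_right_mono) auto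
  finally have mb: "real m * b \<le> a\<^sup>2"
    using mode pos by simp
  define i where "i = real j + 1"
  have i: "0 < i" "i \<le> M" using j by (auto simp: i_def)
  have frac: "(1 - M / L) * y \<le> y - i" if "L \<le> y" for y
  proof -
    have "i \<le> M / L * y"
      using i(2) mult_left_mono[of 1 "y / L" M] L0 that by simp
    then show ?thesis by (simp add: algebra_simps)
  qed
  have frac2: "(1 - M / L) * (y + i) \<le> y" if "L \<le> y" for y
    using frac[of "y + i"] that i by simp
  have u: "0 \<le> 1 - M / L" using j L0 by simp
  have "(1 - M / L) ^ 4 * ((real m + i) * (b + i)) =
     ((1 - M / L) * (real m + i)) * ((1 - M / L) * (b + i)) * (1 - M / L)\<^sup>2"
    by (simp add: power2_eq_square power4_eq_xxxx)
  also have "\<dots> \<le> (real m * b) * (1 - M / L)\<^sup>2"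
    using u L i ab frac2[of "real m"] frac2[of b]
    by (intro mult_right_mono mult_mono) (auto simp: b_def)
  also have "\<dots> \<le> a\<^sup>2 * (1 - M / L)\<^sup>2"
    using mb by (intro mult_right_mono) auto
  also have "\<dots> = ((1 - M / L) * a)\<^sup>2" by (simp add: power_mult_distrib)
  also have "\<dots> \<le> (a - i)\<^sup>2"
    using u ab L frac[of a] by (intro power_mono) (auto simp: a_def)
  finally have key: "(1 - M / L) ^ 4 * ((real m + i) * (b + i)) \<le> (a - i)\<^sup>2" .
  have pp: "(real m + i) * (b + i) > 0" using ab i by simp
  have "(hypergeometric n k (m + j) * (1 - M / L) ^ 4) * ((real m + i) * (b + i)) =
     hypergeometric n k (m + j) * ((1 - M / L) ^ 4 * ((real m + i) * (b + i)))" by simp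
  also have "\<dots> \<le> hypergeometric n k (m + j) * (a - i)\<^sup>2"
    using key hypergeometric_nonneg by (rule mult_left_mono)
  also have "\<dots> = hypergeometric n k (Suc (m + j)) * ((real m + i) * (b + i))"
    using hypergeometric_Suc[of "m + j" k n] m
    by (simp add: a_def b_def i_def algebra_simps)
  finally show ?thesis using pp by (simp add: mult_le_cancel_right)
qed

text \<open>
  The \<open>M\<close> values from the mode upwards are all at least half of the modal value, and the total mass
  is 1.  The constant \<open>8 * M\<^sup>2\<close> makes the loss over \<open>M\<close> steps, \<open>1 - (1 - M / L) ^ (4 * M) \<le> 4 * M\<^sup>2 / L\<close>,
  equal to at most one half.
\<close>
lemma hypergeometric_mode_bound:
  assumes m: "m \<le> k" "2 * k \<le> n"
    and mode: "\<And>j. j \<le> k \<Longrightarrow> hypergeometric n k j \<le> hypergeometric n k m"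
    and M: "1 \<le> M"
    and L: "8 * real M ^ 2 \<le> real m" "8 * real M ^ 2 \<le> real k - real m + 1"
      "8 * real M ^ 2 \<le> real n - 2 * real k + real m"
  shows "hypergeometric n k m \<le> 2 / real M"
proof -
  define L where "L = 8 * real M ^ 2"
  define h where "h = hypergeometric n k m"
  have M1: "real M \<ge> 1" using M by simp
  have M_le: "real M \<le> real M ^ 2" using M1 by (simp add: power2_eq_square)
  then have L0: "L > 0" "8 * real M \<le> L" using M1 unfolding L_def by auto
  have mk: "m + M \<le> k"
  proof -
    have "real M + 1 \<le> real k - real m + 1" using L(2) M_le M1 by linarith
    then show ?thesis by linarith
  qed
  have LM: "real M \<le> 8 * real M ^ 2" using M_le M1 by linarith
  have m1: "1 \<le> m" using L(1) M_le M1 by linarith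
  have pos: "hypergeometric n k (m - 1) > 0"
    using m unfolding hypergeometric_def by (auto intro!: divide_pos_pos mult_pos_pos)
  have u: "0 \<le> 1 - real M / L" "1 - real M / L \<le> 1" using L0 M1 by (auto simp: divide_le_eq)
  have step: "h * (1 - real M / L) ^ (4 * j) \<le> hypergeometric n k (m + j)" if "j \<le> M" for j
    using that
  proof (induction j)
    case (Suc j)
    have "h * (1 - real M / L) ^ (4 * Suc j) = (h * (1 - real M / L) ^ (4 * j)) * (1 - real M / L) ^ 4"
      by (simp add: power_add)
    also have "\<dots> \<le> hypergeometric n k (m + j) * (1 - real M / L) ^ 4"
      using Suc u by (intro mult_right_mono) auto
    also have "\<dots> \<le> hypergeometric n k (Suc (m + j))"
      using Suc.prems m m1 mk mode pos L LM
      by (intro hypergeometric_Suc_ge_near_mode) (auto simp: L_def)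
    finally show ?case by simp
  qed (simp add: h_def)
  have half: "h / 2 \<le> hypergeometric n k (m + j)" if "j < M" for j
  proof -
    have "1 / 2 = 1 - real (4 * M) * (real M / L)"
      using M1 by (simp add: L_def power2_eq_square)
    also have "\<dots> \<le> (1 - real M / L) ^ (4 * M)"
      using Bernoulli_inequality[of "- (real M / L)" "4 * M"] u by simp
    also have "\<dots> \<le> (1 - real M / L) ^ (4 * j)"
      using that u by (intro power_decreasing) auto
    finally have "h * (1 / 2) \<le> h * (1 - real M / L) ^ (4 * j)"
      by (rule mult_left_mono) (simp add: h_def hypergeometric_nonneg)
    then show ?thesis using step[of j] that by simp
  qed
  have "real M * (h / 2) = (\<Sum>j<M. h / 2)" by simp
  also have "\<dots> \<le> (\<Sum>j<M. hypergeometric n k (m + j))"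
    using half by (intro sum_mono) auto
  also have "\<dots> = (\<Sum>i\<in>(\<lambda>j. m + j) ` {..<M}. hypergeometric n k i)"
    by (subst sum.reindex) auto
  also have "\<dots> \<le> (\<Sum>i\<le>k. hypergeometric n k i)"
    using mk hypergeometric_nonneg by (intro sum_mono2) auto
  also have "\<dots> = 1" using m by (intro sum_hypergeometric) auto
  finally show ?thesis using M1 unfolding h_def by (simp add: field_simps)
qed

text \<open>
  The mode \<open>m\<close> lies close to the mean \<open>k\<^sup>2 / n\<close>.  Its being at least as likely as \<open>m - 1\<close> forces
  \<open>m \<le> k / 2\<close>, and its being at least as likely as \<open>m + 1\<close> forces \<open>m + 1 \<ge> k\<^sup>2 / (4 * n)\<close>, so a
  large mean puts the mode far away from both ends of the range.
\<close>
lemma hypergeometric_le: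
  assumes k: "4 * k < n" and M: "1 \<le> M" and big: "8 * real M ^ 2 + 1 \<le> real k ^ 2 / (4 * real n)"
    and r: "r \<le> k"
  shows "hypergeometric n k r \<le> 2 / real M"
proof -
  define h where "h = hypergeometric n k"
  have M1: "real M \<ge> 1" using M by simp
  have n0: "real n > 0" using k by simp
  obtain m where m: "m \<le> k" and mode: "\<And>j. j \<le> k \<Longrightarrow> h j \<le> h m"
  proof -
    have "Max (h ` {..k}) \<in> h ` {..k}" by (rule Max_in) auto
    then obtain m where "m \<le> k" "Max (h ` {..k}) = h m" by (elim imageE) simp
    moreover have "h j \<le> Max (h ` {..k})" if "j \<le> k" for j
      using that by (intro Max_ge) auto
    ultimately show thesis using that by metis
  qed
  have hpos: "h j > 0" if "j \<le> k" for j
    using that k unfolding h_def hypergeometric_def by (auto intro!: divide_pos_pos mult_pos_pos)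
  have kn: "real k ^ 2 / (4 * real n) \<le> real k / 16"
  proof -
    have "real k * (4 * real k) \<le> real k * real n" using k by (intro mult_left_mono) auto
    then show ?thesis using n0 by (simp add: field_simps power2_eq_square)
  qed
  have k16: "16 \<le> real k" using kn big zero_le_power2[of "real M"] by linarith
  have m_half: "real m \<le> real k / 2"
  proof (rule ccontr)
    assume "\<not> real m \<le> real k / 2"
    then have mk: "real m > real k / 2" by simp
    then have m1: "1 \<le> m" using k16 by linarith
    have "h m * (real m * (real n - 2 * real k + real m)) = h (m - 1) * (real k - real m + 1)\<^sup>2"
      using hypergeometric_Suc[of "m - 1" k n] m m1 k by (simp add: h_def of_nat_diff algebra_simps)
    also have "\<dots> \<le> h m * (real k - real m + 1)\<^sup>2"
      using mode[of "m - 1"] m by (intro mult_right_mono) auto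
    finally have "real m * (real n - 2 * real k + real m) \<le> (real k - real m + 1)\<^sup>2"
      using hpos[OF m] by simp
    also have "\<dots> \<le> (real k)\<^sup>2" using m m1 by (intro power_mono) auto
    finally have 1: "real m * (real n - 2 * real k + real m) \<le> (real k)\<^sup>2" .
    have "(real k / 2) * (2 * real k + real k / 2) \<le> real m * (real n - 2 * real k + real m)"
      using mk k by (intro mult_mono) auto
    moreover have "(real k / 2) * (2 * real k + real k / 2) = 5/4 * (real k)\<^sup>2" by (simp add: power2_eq_square)
    moreover have "(real k)\<^sup>2 > 0" using k16 by simp
    ultimately show False using 1 by linarith
  qed
  then have mk: "m < k" using k16 by linarith
  have "h m * (real k - real m)\<^sup>2 = h (Suc m) * ((real m + 1) * (real n - 2 * real k + real m + 1))"
    using hypergeometric_Suc[OF mk] k by (simp add: h_def)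
  also have "\<dots> \<le> h m * ((real m + 1) * (real n - 2 * real k + real m + 1))"
    using mode[of "Suc m"] mk k by (intro mult_right_mono mult_nonneg_nonneg) auto
  finally have "(real k - real m)\<^sup>2 \<le> (real m + 1) * (real n - 2 * real k + real m + 1)"
    using hpos[OF m] by simp
  also have "\<dots> \<le> (real m + 1) * real n"
    using mk by (intro mult_left_mono) auto
  finally have 2: "(real k - real m)\<^sup>2 \<le> (real m + 1) * real n" .
  have "(real k / 2)\<^sup>2 \<le> (real k - real m)\<^sup>2" using m_half by (intro power_mono) auto
  then have "(real k)\<^sup>2 \<le> 4 * ((real m + 1) * real n)" using 2 by (simp add: power_divide)
  then have "real k ^ 2 / (4 * real n) \<le> real m + 1" using n0 by (simp add: field_simps)
  then have Lm: "8 * real M ^ 2 \<le> real m" using big by linarith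
  have "h m \<le> 2 / real M"
    unfolding h_def
  proof (rule hypergeometric_mode_bound[OF m _ _ M Lm])
    show "8 * (real M)\<^sup>2 \<le> real k - real m + 1" using big kn m_half by linarith
    show "8 * (real M)\<^sup>2 \<le> real n - 2 * real k + real m" using big kn k by linarith
  qed (use k mode in \<open>auto simp: h_def\<close>)
  then show ?thesis using mode[OF r] unfolding h_def by linarith
qed

text \<open>
  This is where \<open>k / sqrt n \<longlonglongrightarrow> \<infinity>\<close> enters: it makes the mean \<open>k\<^sup>2 / n\<close> tend to infinity.  For bounded
  mean the distribution would be close to a Poisson distribution and keep atoms of positive mass.
\<close>
lemma hypergeometric_tendsto_0:
  fixes k r :: "nat \<Rightarrow> nat"
  assumes k_large: "filterlim (\<lambda>n. real (k n) / sqrt (real n)) at_top sequentially"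
    and k_small: "(\<lambda>n. real (k n) / real n) \<longlonglongrightarrow> 0"
    and r: "\<forall>\<^sub>F n in sequentially. r n \<le> k n"
  shows "(\<lambda>n. hypergeometric n (k n) (r n)) \<longlonglongrightarrow> 0"
proof (rule LIMSEQ_I)
  fix e :: real assume e: "0 < e"
  obtain M :: nat where M: "2 / e < real M" using reals_Archimedean2 by blast
  then have M1: "M \<ge> 1" using e by (cases M) (auto simp: divide_less_0_iff)
  define B where "B = 4 * (8 * real M ^ 2 + 1)"
  have B: "B \<ge> 1" unfolding B_def by simp
  have "\<forall>\<^sub>F n in sequentially. norm (hypergeometric n (k n) (r n) - 0) < e"
    using r order_tendstoD(2)[OF k_small, of "1/4", simplified]
      filterlim_at_top[THEN iffD1, OF k_large, rule_format, of B] eventually_gt_at_top[of 0]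
  proof eventually_elim
    case (elim n)
    have n0: "real n > 0" using elim by simp
    have "B * 1 \<le> B * B" using B by (intro mult_left_mono) auto
    also have "\<dots> \<le> (real (k n) / sqrt (real n)) * (real (k n) / sqrt (real n))"
      using elim B by (intro mult_mono) auto
    also have "\<dots> = (real (k n))\<^sup>2 / real n" by (simp add: power2_eq_square)
    finally have "8 * real M ^ 2 + 1 \<le> real (k n) ^ 2 / (4 * real n)"
      by (simp add: B_def field_simps)
    moreover have "4 * k n < n" using elim(2) n0 by (simp add: field_simps)
    ultimately have "hypergeometric n (k n) (r n) \<le> 2 / real M"
      using M1 elim by (intro hypergeometric_le)
    also have "\<dots> < e" using M M1 e by (simp add: field_simps)
    finally show ?case using hypergeometric_nonneg[of n "k n" "r n"] by simp
  qed
  then show "\<exists>no. \<forall>n\<ge>no. norm (hypergeometric n (k n) (r n) - 0) < e"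
    by (simp add: eventually_sequentially)
qed

section \<open>The threshold for independent random vertex sets\<close>

text \<open>
  In terms of \<open>\<tau> = t / sqrt (2 / p)\<close> and \<open>\<delta> = t * p = \<tau> * sqrt (2 * p)\<close>, the lower and the upper
  bound on \<^term>\<open>indep_prob\<close> are expressions in \<open>\<tau>\<close> and \<open>\<delta>\<close> alone.  Sparsity turns convergence
  of \<open>\<tau>\<close> into \<open>\<delta> \<longlonglongrightarrow> 0\<close>, and then both bounds have the same limit.  The value \<open>A = 0\<close> covers
  samples far below the threshold.
\<close>
lemma indep_prob_tendsto_exp:
  fixes U :: "nat \<Rightarrow> 'v set" and t d :: "nat \<Rightarrow> nat"
  defines "p \<equiv> \<lambda>n. real (d n) / real (card (U n))"
  assumes graph: "\<forall>\<^sub>F n in sequentially. finite_regular_graph (U n) (adj n) (d n)"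
    and d: "\<forall>\<^sub>F n in sequentially. 1 \<le> d n"
    and t: "\<forall>\<^sub>F n in sequentially. t n \<le> card (U n)"
    and U: "\<forall>\<^sub>F n in sequentially. 1 \<le> card (U n)"
    and sparse: "p \<longlonglongrightarrow> 0"
    and scale: "(\<lambda>n. real (t n) / sqrt (2 / p n)) \<longlonglongrightarrow> A"
  shows "(\<lambda>n. finite_regular_graph.indep_prob (U n) (adj n) (t n)) \<longlonglongrightarrow> exp (- A\<^sup>2)"
proof -
  define \<tau> where "\<tau> n = real (t n) / sqrt (2 / p n)" for n
  define \<delta> where "\<delta> n = \<tau> n * sqrt (2 * p n)" for n
  have \<tau>: "\<tau> \<longlonglongrightarrow> A" using scale by (simp add: \<tau>_def[abs_def])
  have "(\<lambda>n. \<tau> n * sqrt (2 * p n)) \<longlonglongrightarrow> A * sqrt (2 * 0)"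
    by (intro tendsto_intros \<tau> sparse)
  then have \<delta>: "\<delta> \<longlonglongrightarrow> 0" by (simp add: \<delta>_def[abs_def])
  have rescale: "real (t n) * p n = \<delta> n" "(real (t n))\<^sup>2 * p n / 2 = (\<tau> n)\<^sup>2" if "p n > 0" for n
  proof -
    have t: "real (t n) = \<tau> n * sqrt (2 / p n)" using that by (simp add: \<tau>_def)
    have "sqrt (2 / p n) * p n = sqrt (2 / p n * (p n)\<^sup>2)" using that by (subst real_sqrt_mult) simp
    also have "2 / p n * (p n)\<^sup>2 = 2 * p n" using that by (simp add: power2_eq_square)
    finally show "real (t n) * p n = \<delta> n" unfolding t \<delta>_def by (simp add: mult.assoc)
    show "(real (t n))\<^sup>2 * p n / 2 = (\<tau> n)\<^sup>2" unfolding t using that by (simp add: power_mult_distrib)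
  qed
  show ?thesis
  proof (rule tendsto_sandwich)
    show "\<forall>\<^sub>F n in sequentially. exp (- ((\<tau> n)\<^sup>2 / (1 - 2 * \<delta> n))) \<le>
        finite_regular_graph.indep_prob (U n) (adj n) (t n)"
      using graph d t U order_tendstoD(2)[OF \<delta>, of "1 / 2", simplified]
    proof eventually_elim
      case (elim n)
      interpret finite_regular_graph "U n" "adj n" "d n" by (fact elim)
      have "p n > 0" using elim by (simp add: p_def)
      note r = rescale[OF this]
      have p_n: "real (d n) / real (card (U n)) = p n" by (simp add: p_def)
      have tp: "2 * real (t n) * p n = 2 * \<delta> n" using r(1) by simp
      have "exp (- ((real (t n))\<^sup>2 * p n / 2 / (1 - 2 * real (t n) * p n))) \<le> indep_prob (t n)"
        by (rule indep_prob_lower[of "t n", unfolded p_n]) (use elim tp in auto)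
      then show ?case unfolding tp r(2) .
    qed
    show "\<forall>\<^sub>F n in sequentially. finite_regular_graph.indep_prob (U n) (adj n) (t n) \<le>
        exp (- ((\<tau> n)\<^sup>2 - \<delta> n / 2)) + 2 * (\<tau> n)\<^sup>2 * \<delta> n"
      using graph d t U
    proof eventually_elim
      case (elim n)
      interpret finite_regular_graph "U n" "adj n" "d n" by (fact elim)
      have "p n > 0" using elim by (simp add: p_def)
      note r = rescale[OF this]
      have p_n: "real (d n) / real (card (U n)) = p n" by (simp add: p_def)
      have e1: "real (t n) * (real (t n) - 1) / 2 * p n = (\<tau> n)\<^sup>2 - \<delta> n / 2"
        unfolding r[symmetric] by (simp add: field_simps power2_eq_square)
      have e2: "real (t n) ^ 3 * (p n)\<^sup>2 = 2 * (\<tau> n)\<^sup>2 * \<delta> n"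
        unfolding r[symmetric] by (simp add: power2_eq_square power3_eq_cube)
      show ?case
        using indep_prob_upper[of "t n", unfolded p_n] elim unfolding e1 e2 by simp
    qed
    have "(\<lambda>n. exp (- ((\<tau> n)\<^sup>2 / (1 - 2 * \<delta> n)))) \<longlonglongrightarrow> exp (- (A\<^sup>2 / (1 - 2 * 0)))"
      by (intro tendsto_intros \<tau> \<delta>) simp
    then show "(\<lambda>n. exp (- ((\<tau> n)\<^sup>2 / (1 - 2 * \<delta> n)))) \<longlonglongrightarrow> exp (- A\<^sup>2)" by simp
    have "(\<lambda>n. exp (- ((\<tau> n)\<^sup>2 - \<delta> n / 2)) + 2 * (\<tau> n)\<^sup>2 * \<delta> n) \<longlonglongrightarrow>
        exp (- (A\<^sup>2 - 0 / 2)) + 2 * A\<^sup>2 * 0"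
      by (intro tendsto_intros \<tau> \<delta>) simp
    then show "(\<lambda>n. exp (- ((\<tau> n)\<^sup>2 - \<delta> n / 2)) + 2 * (\<tau> n)\<^sup>2 * \<delta> n) \<longlonglongrightarrow> exp (- A\<^sup>2)" by simp
  qed
qed

text \<open>
  A sample far above the threshold contains, for every constant \<open>A\<close>, a sample of about \<open>A\<close> times
  the threshold size, which is independent with probability tending to \<open>exp (- A\<^sup>2)\<close>; and \<open>A\<close> can
  be taken arbitrarily large.
\<close>
lemma indep_prob_tendsto_0:
  fixes U :: "nat \<Rightarrow> 'v set" and t d :: "nat \<Rightarrow> nat"
  defines "p \<equiv> \<lambda>n. real (d n) / real (card (U n))"
  assumes graph: "\<forall>\<^sub>F n in sequentially. finite_regular_graph (U n) (adj n) (d n)"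
    and d: "\<forall>\<^sub>F n in sequentially. 1 \<le> d n"
    and t: "\<forall>\<^sub>F n in sequentially. t n \<le> card (U n)"
    and U: "\<forall>\<^sub>F n in sequentially. 1 \<le> card (U n)"
    and sparse: "p \<longlonglongrightarrow> 0"
    and large: "(\<lambda>n. sqrt (2 / p n)) \<lless> (\<lambda>n. real (t n))"
  shows "(\<lambda>n. finite_regular_graph.indep_prob (U n) (adj n) (t n)) \<longlonglongrightarrow> 0"
proof -
  define s where "s n = sqrt (2 / p n)" for n
  have p_pos: "\<forall>\<^sub>F n in sequentially. p n > 0"
    using d U by eventually_elim (simp add: p_def)
  then have "filterlim p (at_right 0) sequentially"
    using sparse by (simp add: filterlim_at eventually_mono)
  then have "filterlim (\<lambda>n. 2 * inverse (p n)) at_top sequentially"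
    by (intro filterlim_tendsto_pos_mult_at_top[where c = 2] filterlim_compose[OF filterlim_inverse_at_top_right]) auto
  then have s_at_top: "filterlim s at_top sequentially"
    unfolding s_def by (intro filterlim_compose[OF sqrt_at_top]) (simp add: divide_inverse)
  have bound: "\<forall>\<^sub>F n in sequentially. finite_regular_graph.indep_prob (U n) (adj n) (t n) < e"
    if e: "e > 0" for e
  proof -
    \<comment> \<open>With \<open>A \<ge> 1\<close>, \<open>A\<^sup>2 \<ge> A > - ln e\<close>, which makes the limit at multiple \<open>A\<close> smaller than \<open>e\<close>.\<close>
    define A where "A = max 1 (1 - ln e)"
    have A: "A \<ge> 1" "A > - ln e" by (auto simp: A_def)
    then have "A\<^sup>2 > - ln e" using self_le_power[of A 2] by simp
    then have "exp (- A\<^sup>2) < exp (ln e)" by simp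
    then have Ae: "exp (- A\<^sup>2) < e" using e by simp
    define t' where "t' n = nat \<lfloor>A * s n\<rfloor>" for n
    have t'_le: "\<forall>\<^sub>F n in sequentially. t' n \<le> t n"
    proof -
      have ratio: "(\<lambda>n. s n / real (t n)) \<longlonglongrightarrow> 0" and nz: "\<forall>\<^sub>F n in sequentially. real (t n) \<noteq> 0"
        using large unfolding much_less_def s_def by auto
      have "\<forall>\<^sub>F n in sequentially. s n / real (t n) < 1 / A"
        using order_tendstoD(2)[OF ratio, of "1 / A"] A by simp
      with nz show ?thesis
      proof eventually_elim
        case (elim n)
        have "A * s n < real (t n)" using elim A by (simp add: field_simps)
        then show ?case unfolding t'_def by linarith
      qed
    qed
    have "\<forall>\<^sub>F n in sequentially. s n > 0" using s_at_top by (simp add: filterlim_at_top_dense)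
    then have floor: "\<forall>\<^sub>F n in sequentially. A - 1 / s n \<le> real (t' n) / s n \<and> real (t' n) / s n \<le> A"
    proof eventually_elim
      case (elim n)
      have "A * s n > 0" using elim A by simp
      then have "A * s n - 1 \<le> real (t' n)" "real (t' n) \<le> A * s n"
        unfolding t'_def by linarith+
      then show ?case
        using elim divide_right_mono[of "A * s n - 1" "real (t' n)" "s n"]
        by (simp add: diff_divide_distrib divide_le_eq)
    qed
    have "(\<lambda>n. real (t' n) / s n) \<longlonglongrightarrow> A"
    proof (rule tendsto_sandwich)
      show "\<forall>\<^sub>F n in sequentially. A - 1 / s n \<le> real (t' n) / s n"
        "\<forall>\<^sub>F n in sequentially. real (t' n) / s n \<le> A"
        using floor by (auto elim: eventually_mono)
      have "(\<lambda>n. 1 / s n) \<longlonglongrightarrow> 0"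
        using tendsto_inverse_0_at_top[OF s_at_top] by (simp add: inverse_eq_divide)
      from tendsto_diff[OF tendsto_const[of A] this] show "(\<lambda>n. A - 1 / s n) \<longlonglongrightarrow> A" by simp
    qed auto
    moreover have "\<forall>\<^sub>F n in sequentially. t' n \<le> card (U n)"
      using t t'_le by eventually_elim simp
    ultimately have "(\<lambda>n. finite_regular_graph.indep_prob (U n) (adj n) (t' n)) \<longlonglongrightarrow> exp (- A\<^sup>2)"
      using graph d U sparse unfolding p_def s_def by (intro indep_prob_tendsto_exp)
    from order_tendstoD(2)[OF this Ae] graph t t'_le show ?thesis
    proof eventually_elim
      case (elim n)
      then show ?case using finite_regular_graph.indep_prob_antimono[of "U n" "adj n" "d n" "t' n" "t n"] by simp
    qed
  qed
  show ?thesis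
  proof (rule order_tendstoI)
    fix e :: real assume "e < 0"
    show "\<forall>\<^sub>F n in sequentially. e < finite_regular_graph.indep_prob (U n) (adj n) (t n)"
      using graph
    proof eventually_elim
      case (elim n)
      then show ?case using finite_regular_graph.indep_prob_nonneg[of "U n" "adj n" "d n" "t n"] \<open>e < 0\<close> by simp
    qed
  qed (use bound in auto)
qed

section \<open>Overlapping k-sets as a regular graph\<close>

lemma finite_k_subsets: "finite V \<Longrightarrow> finite (k_subsets V k)"
  unfolding k_subsets_def by simp

lemma card_k_subsets: "finite V \<Longrightarrow> card (k_subsets V k) = card V choose k"
  unfolding k_subsets_def by (rule n_subsets)

text \<open>A \<open>k\<close>-set meeting \<open>S\<close> in \<open>r\<close> points splits uniquely into its parts inside and outside \<open>S\<close>.\<close>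
lemma card_k_subsets_overlapping:
  assumes V: "finite V" and S: "S \<in> k_subsets V k" and r: "r \<le> k"
  shows "card {T \<in> k_subsets V k. card (S \<inter> T) = r} = (k choose r) * ((card V - k) choose (k - r))"
proof -
  have S': "S \<subseteq> V" "card S = k" "finite S"
    using S V unfolding k_subsets_def by (auto dest: finite_subset)
  have "bij_betw (\<lambda>(A, B). A \<union> B)
     ({A. A \<subseteq> S \<and> card A = r} \<times> {B. B \<subseteq> V - S \<and> card B = k - r})
     {T \<in> k_subsets V k. card (S \<inter> T) = r}"
  proof (rule bij_betwI[where g = "\<lambda>T. (S \<inter> T, T - S)"])
    show "(\<lambda>(A, B). A \<union> B) \<in> ({A. A \<subseteq> S \<and> card A = r} \<times> {B. B \<subseteq> V - S \<and> card B = k - r}) \<rightarrow>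
       {T \<in> k_subsets V k. card (S \<inter> T) = r}"
    proof safe
      fix A B assume A: "A \<subseteq> S" and B: "B \<subseteq> V - S" "card B = k - card A" and rA: "r = card A"
      have fin: "finite A" "finite B" using A B V S' by (auto dest: finite_subset)
      have "card (A \<union> B) = k"
        using A B fin r rA by (subst card_Un_disjoint) auto
      then show "A \<union> B \<in> k_subsets V k" using A B S' unfolding k_subsets_def by auto
      have "S \<inter> (A \<union> B) = A" using A B by auto
      then show "card (S \<inter> (A \<union> B)) = card A" by simp
    qed
    show "(\<lambda>T. (S \<inter> T, T - S)) \<in> {T \<in> k_subsets V k. card (S \<inter> T) = r} \<rightarrow>
       {A. A \<subseteq> S \<and> card A = r} \<times> {B. B \<subseteq> V - S \<and> card B = k - r}"
      using S' by (auto simp: k_subsets_def card_Diff_subset_Int Int_commute)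
  qed auto
  then have "card {T \<in> k_subsets V k. card (S \<inter> T) = r} =
     card {A. A \<subseteq> S \<and> card A = r} * card {B. B \<subseteq> V - S \<and> card B = k - r}"
    by (simp add: bij_betw_same_card[symmetric] card_cartesian_product)
  also have "\<dots> = (k choose r) * ((card V - k) choose (k - r))"
    using S' V n_subsets[of S r] n_subsets[of "V - S" "k - r"] by (simp add: card_Diff_subset)
  finally show ?thesis .
qed

text \<open>
  This is the generalized Johnson graph; \<open>r < k\<close> is what excludes loops, as a \<open>k\<close>-set overlaps
  itself in \<open>k\<close> elements.
\<close>
lemma overlap_graph_regular:
  assumes "finite V" "r < k"
  shows "finite_regular_graph (k_subsets V k) (\<lambda>S T. card (S \<inter> T) = r)
           ((k choose r) * ((card V - k) choose (k - r)))"
proof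
  show "card {T \<in> k_subsets V k. card (S \<inter> T) = r} = (k choose r) * ((card V - k) choose (k - r))"
    if "S \<in> k_subsets V k" for S
    using card_k_subsets_overlapping[OF assms(1) that, of r] assms(2) by simp
qed (use assms in \<open>auto simp: finite_k_subsets k_subsets_def Int_commute\<close>)

lemma prob_no_overlap_eq_indep_prob:
  assumes V: "finite V" and r: "r < k" and t: "t \<le> card V choose k"
  shows "measure_pmf.prob (random_family V k t) {F. overlap_count r F = 0} =
     finite_regular_graph.indep_prob (k_subsets V k) (\<lambda>S T. card (S \<inter> T) = r) t"
proof -
  interpret finite_regular_graph "k_subsets V k" "\<lambda>S T. card (S \<inter> T) = r"
    "(k choose r) * ((card V - k) choose (k - r))"
    using V r by (rule overlap_graph_regular)
  have card_pos: "card (subsets_of_size t) > 0"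
    unfolding card_subsets_of_size card_k_subsets[OF V] using t by simp
  have "overlap_count r F = 0 \<longleftrightarrow> (\<forall>S\<in>F. \<forall>T\<in>F. card (S \<inter> T) \<noteq> r)"
    if F: "F \<subseteq> k_subsets V k" for F
  proof -
    let ?P = "{{S, T} | S T. S \<in> F \<and> T \<in> F \<and> S \<noteq> T \<and> card (S \<inter> T) = r}"
    have "finite F" using F finite_k_subsets[OF V] by (rule finite_subset)
    then have "finite ?P" by (rule finite_subset[rotated, OF finite_Pow_iff[THEN iffD2]]) auto
    then have "overlap_count r F = 0 \<longleftrightarrow> ?P = {}"
      unfolding overlap_count_def by simp
    also have "\<dots> \<longleftrightarrow> (\<forall>S\<in>F. \<forall>T\<in>F. card (S \<inter> T) \<noteq> r)"
    proof
      assume empty: "?P = {}"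
      show "\<forall>S\<in>F. \<forall>T\<in>F. card (S \<inter> T) \<noteq> r"
      proof (intro ballI notI)
        fix S T assume ST: "S \<in> F" "T \<in> F" "card (S \<inter> T) = r"
        then have "S \<noteq> T" using F adj_irrefl[of S] by auto
        with ST have "{S, T} \<in> ?P" by blast
        then have "{S, T} \<in> {}" by (simp only: empty)
        then show False by simp
      qed
    qed auto
    finally show ?thesis .
  qed
  then have "subsets_of_size t \<inter> {F. overlap_count r F = 0} = indep_sets t"
    unfolding subsets_of_size_def indep_sets_def by auto
  moreover have "random_family V k t = pmf_of_set (subsets_of_size t)"
    unfolding random_family_def subsets_of_size_def ..
  moreover have "subsets_of_size t \<noteq> {}" using card_pos by auto
  ultimately show ?thesis
    by (simp add: measure_pmf_of_set indep_prob_def card_subsets_of_size)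
qed

lemma threshold_eq: "threshold n k r = sqrt (2 / hypergeometric n k r)"
  unfolding threshold_def hypergeometric_def by simp

section \<open>The threshold for overlapping sets\<close>

theorem theorem3:
  fixes V :: "nat \<Rightarrow> 'a set" and k r t :: "nat \<Rightarrow> nat"
  assumes "\<And>n. n \<ge> 1 \<Longrightarrow> finite (V n) \<and> card (V n) = n"
    and "\<And>n. n \<ge> 1 \<Longrightarrow> k n > 0"
    and "filterlim (\<lambda>n. real (k n) / sqrt (real n)) at_top sequentially"
    and "(\<lambda>n. real (k n) / real n) \<longlonglongrightarrow> 0"
    and "\<And>n. n \<ge> 1 \<Longrightarrow> 1 \<le> r n \<and> r n \<le> k n - 1"
    and "\<And>n. n \<ge> 1 \<Longrightarrow> t n \<le> n choose k n"
  defines "t\<^sub>0 \<equiv> \<lambda>n. threshold n (k n) (r n)"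
    and "p \<equiv> \<lambda>n. measure_pmf.prob (random_family (V n) (k n) (t n)) {F. overlap_count (r n) F = 0}"
  shows "((\<lambda>n. real (t n)) \<lless> t\<^sub>0 \<longrightarrow> p \<longlonglongrightarrow> 1) \<and>
         (t\<^sub>0 \<lless> (\<lambda>n. real (t n)) \<longrightarrow> p \<longlonglongrightarrow> 0) \<and>
         (\<forall>A > 0. (\<exists>\<epsilon>. \<epsilon> \<longlonglongrightarrow> 0 \<and> (\<forall>\<^sub>F n in sequentially. real (t n) = (A + \<epsilon> n) * t\<^sub>0 n)) \<longrightarrow>
            p \<longlonglongrightarrow> exp (- A\<^sup>2))"
proof -
  define U where "U = (\<lambda>n. k_subsets (V n) (k n))"
  define adj where "adj = (\<lambda>n S T. card ((S :: 'a set) \<inter> T) = r n)"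
  define d where "d = (\<lambda>n. (k n choose r n) * ((n - k n) choose (k n - r n)))"
  define q where "q = (\<lambda>n. finite_regular_graph.indep_prob (U n) (adj n) (t n))"
  have ev1: "\<forall>\<^sub>F n in sequentially. n \<ge> (1 :: nat)" by (rule eventually_ge_at_top)
  have rk: "r n < k n" if "n \<ge> 1" for n
    using assms(2,5)[OF that] by linarith
  have kn: "\<forall>\<^sub>F n in sequentially. 2 * k n \<le> n"
    using order_tendstoD(2)[OF assms(4), of "1 / 2", simplified] ev1
    by eventually_elim (simp add: field_simps)
  have cardU: "card (U n) = n choose k n" if "n \<ge> 1" for n
    using assms(1)[OF that] by (simp add: U_def card_k_subsets)
  have graph: "\<forall>\<^sub>F n in sequentially. finite_regular_graph (U n) (adj n) (d n)"
    using ev1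
  proof eventually_elim
    case (elim n)
    then show ?case
      using overlap_graph_regular[of "V n" "r n" "k n"] assms(1) rk by (simp add: U_def adj_def d_def)
  qed
  have d: "\<forall>\<^sub>F n in sequentially. 1 \<le> d n"
    using ev1 kn
  proof eventually_elim
    case (elim n)
    then have "0 < (k n choose r n)" "0 < ((n - k n) choose (k n - r n))"
      using rk[of n] by (auto simp: zero_less_binomial_iff)
    then show ?case by (simp add: d_def Suc_le_eq)
  qed
  have t: "\<forall>\<^sub>F n in sequentially. t n \<le> card (U n)"
    using ev1 by eventually_elim (simp add: cardU assms(6))
  have U: "\<forall>\<^sub>F n in sequentially. 1 \<le> card (U n)"
    using ev1 kn by eventually_elim (simp add: cardU Suc_le_eq zero_less_binomial_iff)
  have density: "\<forall>\<^sub>F n in sequentially. hypergeometric n (k n) (r n) = real (d n) / real (card (U n))"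
    using ev1 by eventually_elim (simp add: cardU hypergeometric_def d_def)
  have "(\<lambda>n. hypergeometric n (k n) (r n)) \<longlonglongrightarrow> 0"
    using assms(3,4) by (rule hypergeometric_tendsto_0) (use ev1 in eventually_elim, simp add: rk less_imp_le)
  then have sparse: "(\<lambda>n. real (d n) / real (card (U n))) \<longlonglongrightarrow> 0"
    using density by (rule Lim_transform_eventually)
  have t0: "\<forall>\<^sub>F n in sequentially. t\<^sub>0 n = sqrt (2 / (real (d n) / real (card (U n))))"
    using density by eventually_elim (simp add: t\<^sub>0_def threshold_eq)
  have t0_nz: "\<forall>\<^sub>F n in sequentially. t\<^sub>0 n \<noteq> 0"
    using t0 d U by eventually_elim simp
  have "\<forall>\<^sub>F n in sequentially. q n = p n"
    using ev1
  proof eventually_elim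
    case (elim n)
    then show ?case
      using prob_no_overlap_eq_indep_prob[of "V n" "r n" "k n" "t n"] assms(1,6) rk
      by (simp add: p_def q_def U_def adj_def)
  qed
  then have qp: "p \<longlonglongrightarrow> l" if "q \<longlonglongrightarrow> l" for l
    using that by (metis Lim_transform_eventually)
  have lim: "p \<longlonglongrightarrow> exp (- A\<^sup>2)" if "(\<lambda>n. real (t n) / t\<^sub>0 n) \<longlonglongrightarrow> A" for A
  proof (rule qp)
    have "(\<lambda>n. real (t n) / sqrt (2 / (real (d n) / real (card (U n))))) \<longlonglongrightarrow> A"
      using that by (rule Lim_transform_eventually) (use t0 in eventually_elim, simp)
    then show "q \<longlonglongrightarrow> exp (- A\<^sup>2)"
      unfolding q_def using graph d t U sparse by (intro indep_prob_tendsto_exp)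
  qed
  show ?thesis
  proof (intro conjI impI allI)
    assume "(\<lambda>n. real (t n)) \<lless> t\<^sub>0"
    then show "p \<longlonglongrightarrow> 1" using lim[of 0] by (simp add: much_less_def)
  next
    assume large: "t\<^sub>0 \<lless> (\<lambda>n. real (t n))"
    have "(\<lambda>n. sqrt (2 / (real (d n) / real (card (U n)))) / real (t n)) \<longlonglongrightarrow> 0"
      using large[unfolded much_less_def, THEN conjunct2]
      by (rule Lim_transform_eventually) (use t0 in eventually_elim, simp)
    then have "(\<lambda>n. sqrt (2 / (real (d n) / real (card (U n))))) \<lless> (\<lambda>n. real (t n))"
      using large by (simp add: much_less_def)
    then have "q \<longlonglongrightarrow> 0"
      unfolding q_def using graph d t U sparse by (intro indep_prob_tendsto_0)
    then show "p \<longlonglongrightarrow> 0" by (rule qp)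
  next
    fix A :: real
    assume "\<exists>\<epsilon>. \<epsilon> \<longlonglongrightarrow> 0 \<and> (\<forall>\<^sub>F n in sequentially. real (t n) = (A + \<epsilon> n) * t\<^sub>0 n)"
    then obtain \<epsilon> where \<epsilon>: "\<epsilon> \<longlonglongrightarrow> 0" "\<forall>\<^sub>F n in sequentially. real (t n) = (A + \<epsilon> n) * t\<^sub>0 n"
      by blast
    have "(\<lambda>n. A + \<epsilon> n) \<longlonglongrightarrow> A" using tendsto_add[OF tendsto_const \<epsilon>(1)] by simp
    then have "(\<lambda>n. real (t n) / t\<^sub>0 n) \<longlonglongrightarrow> A"
      by (rule Lim_transform_eventually) (use \<epsilon>(2) t0_nz in eventually_elim, simp)
    then show "p \<longlonglongrightarrow> exp (- A\<^sup>2)" by (rule lim)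
  qed
qed

end
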